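(* Let $X$ be a Hausdorff topological space and let $Y$ be a Hausdorff locally convex linear topological space. Let $F$ be a set-valued map from $X$ to $Y$. Then the following are equivalent: (1) $F$ is a minimal cusco map; (2) $F$ has nonempty compact values and there is a densely defined quasicontinuous, subcontinuous selection $f$ of $F$ such that $\overline{\mathrm{co}}\,\overline{f}(x) = F(x)$ for every $x \in X$; (3) $F$ has nonempty compact values and there is a densely defined hyperplane minimal, subcontinuous selection $f$ of $F$ such that $\overline{\mathrm{co}}\,\overline{f}(x) = F(x)$ for every $x \in X$.
   Context: Linear topological spaces are considered over the reals. A set-valued map (or map) $F$ from $X$ to $Y$ assigns to each $x\in X$ a (possibly empty) subset $F(x)\subset Y$; it is identified with its graph $\{(x,y)\in X\times Y: y\in F(x)\}$. For $U\subset X$, $F(U)=\bigcup\{F(u):u\in U\}$. For maps $F,G$, $G\subset F$ means $G(x)\subset F(x)$ for all $x\in X$. $F$ is upper semicontinuous if for every $x\in X$ and every open $V\supset F(x)$ there is an open neighborhood $U$ of $x$ with $F(U)\subset V$. $F$ is usco if it is upper semicontinuous with nonempty compact values; it is cusco if it is usco and every $F(x)$ is convex. $F$ is minimal cusco if it is cusco and does not properly contain any other cusco map from $X$ to $Y$. A densely defined function is a function $f:A\to Y$ where $A=\mathrm{dom} f$ is a dense subset of $X$; it is a densely defined selection of $F$ if $f(x)\in F(x)$ for every $x\in \mathrm{dom} f$. It is quasicontinuous if it is quasicontinuous on $\mathrm{dom} f$ with the induced topology: for every $x\in\mathrm{dom} f$, every neighborhood $V$ of $f(x)$ and every open neighborhood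 $U$ of $x$ in $\mathrm{dom} f$ there is a nonempty relatively open set $G\subset U$ of $\mathrm{dom} f$ with $f(G)\subset V$. It is subcontinuous if for every $x\in X$ (not only $x\in \mathrm{dom} f$) and every net $(x_i)$ in $\mathrm{dom} f$ converging to $x$, the net $(f(x_i))$ has a convergent subnet in $Y$. An open half-space in $Y$ is a set $\{y\in Y: h(y)<\lambda\}$ with $h$ a nonzero continuous linear functional $Y\to\mathbb{R}$ and $\lambda\in\mathbb{R}$. A densely defined $f$ is hyperplane minimal if for every open half-space $W$ in $Y$ and every relatively open $U\subset \mathrm{dom} f$ with $f(U)\cap W\neq\emptyset$ there is a nonempty relatively open $V\subset U$ with $f(V)\subset W$. $\overline{f}$ denotes the closure of the graph of $f$ in $X\times Y$, and $\overline{f}(x)=\{y\in Y:(x,y)\in\overline{f}\}$ for $x\in X$. $\overline{\mathrm{co}}\,B$ is the closed convex hull of $B\subset Y$. *)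

theory Defs
  imports "HOL-Analysis.Analysis"
begin

text \<open>
  \<open>convex\<close> cannot be used inside the class specification, so its definition is unfolded there;
  \<open>locally_convex\<close> below restates the axiom.
\<close>

class locally_convex_space = real_vector + topological_ab_group_add + t2_space +
  assumes tendsto_scaleR_nhds_Pair:
    "LIM p (nhds c \<times>\<^sub>F nhds x). fst p *\<^sub>R snd p :> nhds (c *\<^sub>R x)"
  and locally_convex_raw:
    "open U \<Longrightarrow> x \<in> U \<Longrightarrow> \<exists>C. open C \<and> x \<in> C \<and> C \<subseteq> U \<and>
       (\<forall>a\<in>C. \<forall>b\<in>C. \<forall>u\<ge>0. \<forall>v\<ge>0. u + v = 1 \<longrightarrow> u *\<^sub>R a + v *\<^sub>R b \<in> C)"

lemma locally_convex:
  fixes x :: "'y::locally_convex_space"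
  assumes "open U" "x \<in> U"
  shows "\<exists>C. open C \<and> convex C \<and> x \<in> C \<and> C \<subseteq> U"
  using locally_convex_raw[OF assms] unfolding convex_def by blast

text \<open>A set-valued map is a function \<open>'x \<Rightarrow> 'y set\<close>.\<close>

definition usc_map :: "('x::topological_space \<Rightarrow> 'y::topological_space set) \<Rightarrow> bool" where
  "usc_map F \<longleftrightarrow> (\<forall>x V. open V \<and> F x \<subseteq> V \<longrightarrow>
     (\<exists>U. open U \<and> x \<in> U \<and> (\<Union>u\<in>U. F u) \<subseteq> V))"

definition usco :: "('x::topological_space \<Rightarrow> 'y::topological_space set) \<Rightarrow> bool" where
  "usco F \<longleftrightarrow> usc_map F \<and> (\<forall>x. F x \<noteq> {} \<and> compact (F x))"

definition cusco :: "('x::topological_space \<Rightarrow> 'y::{real_vector, topological_space} set) \<Rightarrow> bool" where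
  "cusco F \<longleftrightarrow> usco F \<and> (\<forall>x. convex (F x))"

definition minimal_cusco ::
  "('x::topological_space \<Rightarrow> 'y::{real_vector, topological_space} set) \<Rightarrow> bool" where
  "minimal_cusco F \<longleftrightarrow> cusco F \<and> (\<forall>G. cusco G \<and> (\<forall>x. G x \<subseteq> F x) \<longrightarrow> G = F)"

text \<open>
  A densely defined function is given by its domain \<open>A\<close> together with a total function \<open>f\<close>;
  none of the notions below depends on the values of \<open>f\<close> outside \<open>A\<close>.
\<close>

definition densely_defined_selection ::
  "'x::topological_space set \<Rightarrow> ('x \<Rightarrow> 'y) \<Rightarrow> ('x \<Rightarrow> 'y set) \<Rightarrow> bool" where
  "densely_defined_selection A f F \<longleftrightarrow> closure A = UNIV \<and> (\<forall>x\<in>A. f x \<in> F x)"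

text \<open>\<open>V\<close> ranges over all neighbourhoods of \<open>f x\<close>, not only the open ones.\<close>

definition quasicontinuous_on ::
  "'x::topological_space set \<Rightarrow> ('x \<Rightarrow> 'y::topological_space) \<Rightarrow> bool" where
  "quasicontinuous_on A f \<longleftrightarrow> (\<forall>x\<in>A. \<forall>V U. f x \<in> interior V \<and>
     openin (top_of_set A) U \<and> x \<in> U \<longrightarrow>
     (\<exists>G. G \<noteq> {} \<and> openin (top_of_set A) G \<and> G \<subseteq> U \<and> f ` G \<subseteq> V))"

definition open_half_space :: "'y::{real_vector, topological_space} set \<Rightarrow> bool" where
  "open_half_space W \<longleftrightarrow> (\<exists>(h :: 'y \<Rightarrow> real) c.
     linear h \<and> continuous_on UNIV h \<and> h \<noteq> (\<lambda>_. 0) \<and> W = {y. h y < c})"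

definition hyperplane_minimal_on ::
  "'x::topological_space set \<Rightarrow> ('x \<Rightarrow> 'y::{real_vector, topological_space}) \<Rightarrow> bool" where
  "hyperplane_minimal_on A f \<longleftrightarrow> (\<forall>W U. open_half_space W \<and>
     openin (top_of_set A) U \<and> f ` U \<inter> W \<noteq> {} \<longrightarrow>
     (\<exists>V. V \<noteq> {} \<and> openin (top_of_set A) V \<and> V \<subseteq> U \<and> f ` V \<subseteq> W))"

definition graph_closure ::
  "'x::topological_space set \<Rightarrow> ('x \<Rightarrow> 'y::topological_space) \<Rightarrow> 'x \<Rightarrow> 'y set" where
  "graph_closure A f x = {y. (x, y) \<in> closure {(a, f a) |a. a \<in> A}}"

definition closed_convex_hull :: "'y::{real_vector, topological_space} set \<Rightarrow> 'y set" where
  "closed_convex_hull B = closure (convex hull B)"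

text \<open>
  A net is a function \<open>s\<close> on a directed set \<open>(D, r)\<close>; it converges to \<open>x\<close> iff
  \<open>s\<close> tends to \<open>x\<close> along \<open>tails D r\<close>.
\<close>

definition directed_set :: "'i set \<Rightarrow> ('i \<Rightarrow> 'i \<Rightarrow> bool) \<Rightarrow> bool" where
  "directed_set D r \<longleftrightarrow> D \<noteq> {} \<and> reflp_on D r \<and> transp_on D r \<and>
     (\<forall>i\<in>D. \<forall>j\<in>D. \<exists>k\<in>D. r i k \<and> r j k)"

definition tails :: "'i set \<Rightarrow> ('i \<Rightarrow> 'i \<Rightarrow> bool) \<Rightarrow> 'i filter" where
  "tails D r = (INF i\<in>D. principal {j\<in>D. r i j})"

text \<open>\<open>s \<circ> p\<close> is a subnet of a net \<open>s\<close> on \<open>(D, r)\<close> with index set \<open>(E, q)\<close>.\<close>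

definition subnet_index ::
  "'e set \<Rightarrow> ('e \<Rightarrow> 'e \<Rightarrow> bool) \<Rightarrow> ('e \<Rightarrow> 'i) \<Rightarrow> 'i set \<Rightarrow> ('i \<Rightarrow> 'i \<Rightarrow> bool) \<Rightarrow> bool" where
  "subnet_index E q p D r \<longleftrightarrow> directed_set E q \<and> p ` E \<subseteq> D \<and>
     (\<forall>i\<in>D. \<exists>e0\<in>E. \<forall>e\<in>E. q e0 e \<longrightarrow> r i (p e))"

text \<open>
  Types cannot be quantified over inside a definition, so the index types have to be fixed:
  \<open>'x set \<times> 'x\<close> for the net and \<open>'i \<times> 'y set\<close> for a subnet of a net indexed by \<open>'i\<close>.
  This is no restriction. By \<open>subnet_index_change\<close> a convergent subnet with any index type
  yields one indexed by \<open>'i \<times> 'y set\<close>, and by \<open>subcontinuous_on_all_nets\<close> the definition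
  implies the same property for nets with arbitrary index type.
\<close>

definition has_convergent_subnet ::
  "'i set \<Rightarrow> ('i \<Rightarrow> 'i \<Rightarrow> bool) \<Rightarrow> ('i \<Rightarrow> 'y::topological_space) \<Rightarrow> bool" where
  "has_convergent_subnet D r t \<longleftrightarrow>
     (\<exists>(E :: ('i \<times> 'y set) set) q p y. subnet_index E q p D r \<and> ((t \<circ> p) \<longlongrightarrow> y) (tails E q))"

definition subcontinuous_on ::
  "'x::topological_space set \<Rightarrow> ('x \<Rightarrow> 'y::topological_space) \<Rightarrow> bool" where
  "subcontinuous_on A f \<longleftrightarrow> (\<forall>x (D :: ('x set \<times> 'x) set) r s.
     directed_set D r \<and> s ` D \<subseteq> A \<and> (s \<longlongrightarrow> x) (tails D r) \<longrightarrow>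
     has_convergent_subnet D r (f \<circ> s))"

lemma eventually_tails:
  assumes "directed_set D r"
  shows "eventually P (tails D r) \<longleftrightarrow> (\<exists>i\<in>D. \<forall>j\<in>D. r i j \<longrightarrow> P j)"
proof -
  have "eventually P (tails D r) \<longleftrightarrow> (\<exists>i\<in>D. eventually P (principal {j\<in>D. r i j}))"
    unfolding tails_def
  proof (rule eventually_INF_base)
    show "D \<noteq> {}" using assms by (simp add: directed_set_def)
  next
    fix i j assume ij: "i \<in> D" "j \<in> D"
    then obtain k where k: "k \<in> D" "r i k" "r j k"
      using assms unfolding directed_set_def by blast
    have tr: "transp_on D r" using assms by (simp add: directed_set_def)
    have "{l \<in> D. r k l} \<subseteq> {l \<in> D. r i l} \<inter> {l \<in> D. r j l}"
      using ij k transp_onD[OF tr] by blast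
    then show "\<exists>x\<in>D. principal {l \<in> D. r x l}
        \<le> inf (principal {l \<in> D. r i l}) (principal {l \<in> D. r j l})"
      using k(1) by auto
  qed
  then show ?thesis by (auto simp: eventually_principal)
qed

lemma convergent_subnet_frequently:
  assumes sub: "subnet_index E q p D r" and lim: "((t \<circ> p) \<longlongrightarrow> y) (tails E q)"
    and V: "open V" "y \<in> V" and i: "i \<in> D"
  shows "\<exists>e\<in>E. r i (p e) \<and> t (p e) \<in> V"
proof -
  have dirE: "directed_set E q" using sub by (simp add: subnet_index_def)
  have "eventually (\<lambda>e. (t \<circ> p) e \<in> V) (tails E q)"
    using lim V by (rule topological_tendstoD)
  then obtain e1 where e1: "e1 \<in> E" "\<And>e. e \<in> E \<Longrightarrow> q e1 e \<Longrightarrow> t (p e) \<in> V"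
    by (auto simp: eventually_tails[OF dirE])
  obtain e0 where e0: "e0 \<in> E" "\<And>e. e \<in> E \<Longrightarrow> q e0 e \<Longrightarrow> r i (p e)"
    using sub i unfolding subnet_index_def by blast
  obtain e where "e \<in> E" "q e0 e" "q e1 e"
    using dirE e0(1) e1(1) unfolding directed_set_def by blast
  then show ?thesis using e0(2) e1(2) by blast
qed

lemma has_convergent_subnetI:
  fixes t :: "'i \<Rightarrow> 'y::topological_space"
  assumes D: "directed_set D r"
    and clus: "\<And>V i. open V \<Longrightarrow> y \<in> V \<Longrightarrow> i \<in> D \<Longrightarrow> \<exists>j\<in>D. r i j \<and> t j \<in> V"
  shows "has_convergent_subnet D r t"
proof -
  define E where "E = {(j, V). j \<in> D \<and> open V \<and> y \<in> V \<and> t j \<in> V}"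
  define q where "q = (\<lambda>(j, V) (k, W). r j k \<and> (W :: 'y set) \<subseteq> V)"
  have refl: "\<And>i. i \<in> D \<Longrightarrow> r i i"
    using D by (auto simp: directed_set_def dest: reflp_onD)
  have trans: "\<And>i j k. i \<in> D \<Longrightarrow> j \<in> D \<Longrightarrow> k \<in> D \<Longrightarrow> r i j \<Longrightarrow> r j k \<Longrightarrow> r i k"
    using D unfolding directed_set_def by (meson transp_onD)
  have dirE: "directed_set E q"
    unfolding directed_set_def
  proof (intro conjI ballI)
    from D obtain i where "i \<in> D" by (auto simp: directed_set_def)
    then have "(i, UNIV) \<in> E" by (simp add: E_def)
    then show "E \<noteq> {}" by blast
    show "reflp_on E q" by (auto simp: reflp_on_def q_def E_def refl)
    show "transp_on E q"
      by (rule transp_onI) (auto simp: q_def E_def intro: trans[rotated 3])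
  next
    fix a b assume "a \<in> E" "b \<in> E"
    then obtain i V j W where ab: "a = (i, V)" "b = (j, W)" "i \<in> D" "j \<in> D"
        "open V" "open W" "y \<in> V" "y \<in> W"
      by (auto simp: E_def)
    then obtain k where k: "k \<in> D" "r i k" "r j k"
      using D unfolding directed_set_def by blast
    obtain l where l: "l \<in> D" "r k l" "t l \<in> V \<inter> W"
      using clus[of "V \<inter> W" k] ab k by auto
    have "(l, V \<inter> W) \<in> E" using ab l by (auto simp: E_def)
    moreover have "q a (l, V \<inter> W)" "q b (l, V \<inter> W)"
      using ab k l trans[OF ab(3) k(1) l(1)] trans[OF ab(4) k(1) l(1)]
      unfolding q_def by auto
    ultimately show "\<exists>c\<in>E. q a c \<and> q b c" by blast
  qed
  have sub: "subnet_index E q fst D r"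
    unfolding subnet_index_def
  proof (intro conjI ballI dirE)
    show "fst ` E \<subseteq> D" by (auto simp: E_def)
  next
    fix i assume "i \<in> D"
    then show "\<exists>e0\<in>E. \<forall>e\<in>E. q e0 e \<longrightarrow> r i (fst e)"
      by (intro bexI[of _ "(i, UNIV)"]) (auto simp: E_def q_def)
  qed
  have "((t \<circ> fst) \<longlongrightarrow> y) (tails E q)"
  proof (rule topological_tendstoI)
    fix V assume V: "open V" "y \<in> V"
    obtain i where "i \<in> D" using D by (auto simp: directed_set_def)
    then obtain j where "j \<in> D" "t j \<in> V" using clus V by blast
    then have "(j, V) \<in> E" using V by (simp add: E_def)
    then show "eventually (\<lambda>e. (t \<circ> fst) e \<in> V) (tails E q)"
      unfolding eventually_tails[OF dirE]
      by (rule bexI[rotated]) (auto simp: E_def q_def)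
  qed
  then show ?thesis unfolding has_convergent_subnet_def using sub by blast
qed

lemma subnet_index_change:
  assumes "directed_set D r" "subnet_index E q p D r" "((t \<circ> p) \<longlongrightarrow> y) (tails E q)"
  shows "has_convergent_subnet D r t"
proof (rule has_convergent_subnetI[OF assms(1)])
  fix V i assume "open V" "y \<in> V" "i \<in> D"
  from convergent_subnet_frequently[OF assms(2,3) this]
  show "\<exists>j\<in>D. r i j \<and> t j \<in> V" using assms(2) by (auto simp: subnet_index_def)
qed

lemma subcontinuous_on_all_nets:
  fixes f :: "'x::topological_space \<Rightarrow> 'y::topological_space" and D :: "'i set"
  assumes f: "subcontinuous_on A f" and D: "directed_set D r"
    and sA: "s ` D \<subseteq> A" and lim: "(s \<longlongrightarrow> x) (tails D r)"
  shows "has_convergent_subnet D r (f \<circ> s)"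
proof -
  define T where "T = (\<lambda>i. s ` {j\<in>D. r i j})"
  define D0 where "D0 = {(S, a). a \<in> S \<and> S \<subseteq> A \<and> (\<exists>i\<in>D. T i \<subseteq> S)}"
  define r0 where "r0 = (\<lambda>(S :: 'x set, a :: 'x) (S' :: 'x set, a' :: 'x). S' \<subseteq> S)"
  have refl: "\<And>i. i \<in> D \<Longrightarrow> r i i"
    using D by (auto simp: directed_set_def dest: reflp_onD)
  have trans: "\<And>i j k. i \<in> D \<Longrightarrow> j \<in> D \<Longrightarrow> k \<in> D \<Longrightarrow> r i j \<Longrightarrow> r j k \<Longrightarrow> r i k"
    using D unfolding directed_set_def by (meson transp_onD)
  have Tin: "(T i, s i) \<in> D0" if "i \<in> D" for i
    using that sA refl by (auto simp: D0_def T_def)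
  have dir0: "directed_set D0 r0"
    unfolding directed_set_def
  proof (intro conjI ballI)
    show "D0 \<noteq> {}" using D Tin by (auto simp: directed_set_def)
    show "reflp_on D0 r0" by (auto simp: reflp_on_def r0_def)
    show "transp_on D0 r0" by (auto simp: transp_on_def r0_def)
  next
    fix a b assume "a \<in> D0" "b \<in> D0"
    then obtain S i S' j where ab: "fst a = S" "fst b = S'" "i \<in> D" "j \<in> D" "T i \<subseteq> S" "T j \<subseteq> S'"
      by (auto simp: D0_def)
    then obtain k where k: "k \<in> D" "r i k" "r j k"
      using D unfolding directed_set_def by blast
    have "T k \<subseteq> T i \<inter> T j"
      using k trans[OF ab(3) k(1)] trans[OF ab(4) k(1)] unfolding T_def by blast
    then have "r0 a (T k, s k)" "r0 b (T k, s k)"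
      using ab by (auto simp: r0_def split: prod.splits)
    then show "\<exists>c\<in>D0. r0 a c \<and> r0 b c" using Tin[OF k(1)] by blast
  qed
  have "(snd \<longlongrightarrow> x) (tails D0 r0)"
  proof (rule topological_tendstoI)
    fix U assume "open U" "x \<in> U"
    from topological_tendstoD[OF lim this] obtain i where i: "i \<in> D" "T i \<subseteq> U"
      by (auto simp: eventually_tails[OF D] T_def)
    show "eventually (\<lambda>d. snd d \<in> U) (tails D0 r0)"
      unfolding eventually_tails[OF dir0]
      by (rule bexI[OF _ Tin[OF i(1)]]) (use i(2) in \<open>auto simp: r0_def D0_def\<close>)
  qed
  moreover have "snd ` D0 \<subseteq> A" by (auto simp: D0_def)
  ultimately have "has_convergent_subnet D0 r0 (f \<circ> snd)"
    using f dir0 unfolding subcontinuous_on_def by blast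
  then obtain E :: "(('x set \<times> 'x) \<times> 'y set) set" and q p y where
    sub: "subnet_index E q p D0 r0" and conv: "((f \<circ> snd \<circ> p) \<longlongrightarrow> y) (tails E q)"
    unfolding has_convergent_subnet_def by blast
  show ?thesis
  proof (rule has_convergent_subnetI[OF D])
    fix V i assume V: "open V" "y \<in> V" and i: "i \<in> D"
    obtain e where e: "e \<in> E" "r0 (T i, s i) (p e)" "(f \<circ> snd) (p e) \<in> V"
      using convergent_subnet_frequently[OF sub conv V Tin[OF i]] by blast
    have "p e \<in> D0" using sub e(1) by (auto simp: subnet_index_def)
    then have "snd (p e) \<in> T i" using e(2) by (auto simp: r0_def D0_def)
    then show "\<exists>j\<in>D. r i j \<and> (f \<circ> s) j \<in> V" using e(3) by (auto simp: T_def)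
  qed
qed

end

theory Submission
  imports Defs
begin

text \<open>
  A minimal cusco map contains a minimal usco map \<open>G\<close> by Zorn's lemma, and every selection \<open>f\<close> of
  \<open>G\<close> is quasicontinuous: if \<open>f x \<in> V\<close> and no \<open>G u\<close> with \<open>u \<in> U\<close> were contained in the open set \<open>V\<close>,
  then replacing \<open>G u\<close> by \<open>G u - V\<close> on \<open>U\<close> would give a smaller usco map. Taking closed convex hulls
  in the closure of the graph of \<open>f\<close> again gives a cusco map below \<open>F\<close>, so it equals \<open>F\<close>.
  Conversely, let \<open>f\<close> be hyperplane minimal and suppose that a cusco map \<open>G\<close> below \<open>F\<close> misses a point
  \<open>y\<close> of the closed graph over \<open>x\<close>. A hyperplane strictly separates \<open>y\<close> from \<open>G u\<close> for all \<open>u\<close> near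
  \<open>x\<close>, while hyperplane minimality puts \<open>F v\<close> on the side of \<open>y\<close> for some such \<open>v\<close>, so \<open>G v\<close> is empty.
\<close>

section \<open>Locally convex spaces\<close>

lemma tendsto_scaleR_lcs:
  fixes g :: "'a \<Rightarrow> 'y::locally_convex_space"
  assumes "(f \<longlongrightarrow> c) F" "(g \<longlongrightarrow> x) F"
  shows "((\<lambda>t. f t *\<^sub>R g t) \<longlongrightarrow> c *\<^sub>R x) F"
  using filterlim_compose[OF tendsto_scaleR_nhds_Pair filterlim_Pair[OF assms]] by simp

lemma open_translates:
  fixes N :: "'y::locally_convex_space set"
  assumes "open N"
  shows "open {k + a |k a. k \<in> K \<and> a \<in> N}"
proof -
  have "{k + a |k a. k \<in> K \<and> a \<in> N} = (\<Union>k\<in>K. (\<lambda>x. x - k) -` N)"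
  proof (intro equalityI subsetI)
    fix x assume "x \<in> (\<Union>k\<in>K. (\<lambda>x. x - k) -` N)"
    then obtain k where "k \<in> K" "x - k \<in> N" by blast
    moreover have "x = k + (x - k)" by simp
    ultimately show "x \<in> {k + a |k a. k \<in> K \<and> a \<in> N}" by blast
  next
    fix x assume "x \<in> {k + a |k a. k \<in> K \<and> a \<in> N}"
    then obtain k a where "k \<in> K" "a \<in> N" "x = k + a" by blast
    then show "x \<in> (\<Union>k\<in>K. (\<lambda>x. x - k) -` N)" by (intro UN_I[of k]) auto
  qed
  moreover have "open ((\<lambda>x. x - k) -` N)" for k
    by (intro open_vimage assms continuous_intros)
  ultimately show ?thesis by auto
qed

lemma convex_translates:
  fixes K N :: "'y::real_vector set"
  assumes "convex K" "convex N"
  shows "convex {k + a |k a. k \<in> K \<and> a \<in> N}"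
proof -
  have "{k + a |k a. k \<in> K \<and> a \<in> N} = (\<Union>k\<in>K. \<Union>a\<in>N. {k + a})" by auto
  then show ?thesis using convex_sums[OF assms] by simp
qed

text \<open>For fixed weights the combination map is continuous on the product, and the closure of
  \<open>S \<times> S\<close> is \<open>closure S \<times> closure S\<close>, so the convexity of
  \<open>S\<close> passes to the limit.\<close>

lemma convex_closure_lcs:
  fixes S :: "'y::locally_convex_space set"
  assumes "convex S"
  shows "convex (closure S)"
proof (rule convexI)
  fix x y :: 'y and u v :: real
  assume *: "x \<in> closure S" "y \<in> closure S" "0 \<le> u" "0 \<le> v" "u + v = 1"
  let ?g = "\<lambda>p. u *\<^sub>R fst p + v *\<^sub>R snd p :: 'y"
  have "continuous_on (closure (S \<times> S)) ?g"
    unfolding continuous_on_def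
    by (intro ballI tendsto_add tendsto_scaleR_lcs tendsto_const tendsto_fst tendsto_snd tendsto_ident_at)
  moreover have "?g ` (S \<times> S) \<subseteq> closure S"
    using closure_subset convexD[OF assms] * by fastforce
  ultimately have "?g ` closure (S \<times> S) \<subseteq> closure S"
    by (intro image_closure_subset) auto
  then have "?g (x, y) \<in> closure S"
    using * unfolding closure_Times by blast
  then show "u *\<^sub>R x + v *\<^sub>R y \<in> closure S" by simp
qed

lemma convex_closed_convex_hull:
  fixes B :: "'y::locally_convex_space set"
  shows "convex (closed_convex_hull B)"
  unfolding closed_convex_hull_def by (intro convex_closure_lcs convex_convex_hull)

lemma subset_closed_convex_hull: "B \<subseteq> closed_convex_hull B"
  unfolding closed_convex_hull_def using hull_subset closure_subset by fast

lemma closed_convex_hull_least: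
  assumes "B \<subseteq> C" "convex C" "closed C"
  shows "closed_convex_hull B \<subseteq> C"
  unfolding closed_convex_hull_def using assms by (intro closure_minimal hull_minimal)

lemma symmetric_convex_nbhd:
  fixes U :: "'y::locally_convex_space set"
  assumes "open U" "0 \<in> U"
  obtains N where "open N" "convex N" "0 \<in> N" "N \<subseteq> U" "\<And>a. a \<in> N \<Longrightarrow> - a \<in> N"
proof -
  obtain C where C: "open C" "convex C" "0 \<in> C" "C \<subseteq> U"
    using locally_convex[OF assms] by blast
  have "open (uminus -` C)"
    by (intro open_vimage C continuous_intros)
  moreover have "convex (uminus -` C)"
    by (rule convex_linear_vimage) (use C in \<open>auto intro: linear_uminus\<close>)
  ultimately show ?thesis
    using C by (intro that[of "C \<inter> uminus -` C"]) (auto intro: convex_Int)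
qed

text \<open>Continuity of addition gives each \<open>k\<close> its own neighbourhood
  \<open>M k\<close> with room for three summands. Finitely many translates \<open>k + M k\<close>
  cover \<open>K\<close>; the intersection of these \<open>M k\<close> serves all of
  \<open>K\<close>, because the third summand absorbs the distance from a point to the centre of its
  translate. The two remaining summands allow thickening \<open>K\<close> once and then taking a
  closure.\<close>

lemma compact_uniform_nbhd:
  fixes K :: "'y::locally_convex_space set"
  assumes K: "compact K" and V: "open V" "K \<subseteq> V"
  obtains N where "open N" "convex N" "0 \<in> N" "\<And>a. a \<in> N \<Longrightarrow> - a \<in> N"
    "\<And>k a b. k \<in> K \<Longrightarrow> a \<in> N \<Longrightarrow> b \<in> N \<Longrightarrow> k + a + b \<in> V"
proof -
  have "\<exists>N. open N \<and> convex N \<and> 0 \<in> N \<and> (\<forall>a\<in>N. - a \<in> N) \<and>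
      (\<forall>a\<in>N. \<forall>b\<in>N. \<forall>c\<in>N. k + a + b + c \<in> V)" if "k \<in> K" for k
  proof -
    let ?g = "\<lambda>p. k + fst p + fst (snd p) + snd (snd p)"
    have "open (?g -` V)"
      by (intro open_vimage V continuous_intros)
    moreover have "(0, 0, 0) \<in> ?g -` V" using that V by auto
    ultimately obtain A B where AB: "open A" "open B" "(0, 0, 0) \<in> A \<times> B" "A \<times> B \<subseteq> ?g -` V"
      by (rule open_prod_elim)
    then have B0: "(0, 0) \<in> B" by simp
    obtain B1 B2 where B: "open B1" "open B2" "(0, 0) \<in> B1 \<times> B2" "B1 \<times> B2 \<subseteq> B"
      using AB(2) B0 by (rule open_prod_elim)
    obtain N where N: "open N" "convex N" "0 \<in> N" "N \<subseteq> A \<inter> B1 \<inter> B2" "\<And>a. a \<in> N \<Longrightarrow> - a \<in> N"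
      using symmetric_convex_nbhd[of "A \<inter> B1 \<inter> B2"] AB B by (auto simp: open_Int)
    have "k + a + b + c \<in> V" if "a \<in> N" "b \<in> N" "c \<in> N" for a b c
    proof -
      have "(a, b, c) \<in> ?g -` V" using that N(4) AB(4) B(4) by blast
      then show ?thesis by simp
    qed
    then show ?thesis using N by blast
  qed
  then obtain M where M: "\<And>k. k \<in> K \<Longrightarrow> open (M k) \<and> convex (M k) \<and> 0 \<in> M k \<and>
      (\<forall>a\<in>M k. - a \<in> M k) \<and> (\<forall>a\<in>M k. \<forall>b\<in>M k. \<forall>c\<in>M k. k + a + b + c \<in> V)"
    by metis
  have "open {j + a |j a. j \<in> {k} \<and> a \<in> M k}" if "k \<in> K" for k
    using M that by (intro open_translates) blast
  moreover have "K \<subseteq> (\<Union>k\<in>K. {j + a |j a. j \<in> {k} \<and> a \<in> M k})"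
    using M by force
  ultimately obtain I where I: "I \<subseteq> K" "finite I" "K \<subseteq> (\<Union>k\<in>I. {j + a |j a. j \<in> {k} \<and> a \<in> M k})"
    by (rule compactE_image[OF K])
  show ?thesis
  proof (rule that[of "\<Inter>k\<in>I. M k"])
    show "open (\<Inter>k\<in>I. M k)" using I M by (intro open_INT) auto
    show "convex (\<Inter>k\<in>I. M k)" using I M by (intro convex_INT) auto
    show "0 \<in> (\<Inter>k\<in>I. M k)" "\<And>a. a \<in> (\<Inter>k\<in>I. M k) \<Longrightarrow> - a \<in> (\<Inter>k\<in>I. M k)"
      using I M by auto
    fix k a b assume k: "k \<in> K" and ab: "a \<in> (\<Inter>k\<in>I. M k)" "b \<in> (\<Inter>k\<in>I. M k)"
    obtain j c where j: "j \<in> I" "k = j + c" "c \<in> M j"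
      using I(3) k by blast
    moreover have "j \<in> K" "a \<in> M j" "b \<in> M j"
      using ab I(1) j(1) by auto
    ultimately show "k + a + b \<in> V" using M[of j] by simp
  qed
qed

text \<open>This provides regularity around compact sets, with convexity preserved: \<open>W\<close>
  is \<open>K + N\<close> for a small symmetric convex \<open>N\<close>, and its closure stays
  inside \<open>K + N + N\<close>.\<close>

lemma compact_nbhd_closure:
  fixes K :: "'y::locally_convex_space set"
  assumes K: "compact K" and V: "open V" "K \<subseteq> V"
  obtains W where "open W" "K \<subseteq> W" "closure W \<subseteq> V" "convex K \<longrightarrow> convex W"
proof -
  obtain N where N: "open N" "convex N" "0 \<in> N" "\<And>a. a \<in> N \<Longrightarrow> - a \<in> N"
    "\<And>k a b. k \<in> K \<Longrightarrow> a \<in> N \<Longrightarrow> b \<in> N \<Longrightarrow> k + a + b \<in> V"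
    using compact_uniform_nbhd[OF assms] by metis
  let ?W = "{k + a |k a. k \<in> K \<and> a \<in> N}"
  have "closure ?W \<subseteq> V"
  proof
    fix z assume z: "z \<in> closure ?W"
    have "open {j + a |j a. j \<in> {z} \<and> a \<in> N}" by (rule open_translates[OF N(1)])
    moreover have "z \<in> {j + a |j a. j \<in> {z} \<and> a \<in> N}" using N(3) by force
    ultimately obtain k a b where kab: "k \<in> K" "a \<in> N" "b \<in> N" "k + a = z + b"
      using z unfolding closure_iff_nhds_not_empty by blast
    then have "z = k + a + - b" by (simp add: algebra_simps)
    then show "z \<in> V" using N(4,5) kab by metis
  qed
  moreover have "K \<subseteq> ?W" using N(3) by force
  ultimately show ?thesis
    using open_translates[OF N(1)] convex_translates[OF _ N(2)] that by blast
qed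

section \<open>Hahn--Banach separation\<close>

text \<open>Zorn's lemma for the reversed order. Lower bounds are requested for nonempty chains
  only, since below they are pointwise infima of functionals or intersections of maps.\<close>

lemma Zorn_minimal:
  fixes A :: "'a::order set"
  assumes "A \<noteq> {}"
    and chain: "\<And>C. C \<noteq> {} \<Longrightarrow> C \<subseteq> A \<Longrightarrow> (\<And>a b. a \<in> C \<Longrightarrow> b \<in> C \<Longrightarrow> a \<le> b \<or> b \<le> a) \<Longrightarrow>
      \<exists>l\<in>A. \<forall>a\<in>C. l \<le> a"
  shows "\<exists>m\<in>A. \<forall>a\<in>A. a \<le> m \<longrightarrow> a = m"
proof (rule predicate_Zorn)
  show "partial_order_on A (relation_of (\<ge>) A)"
    by (rule partial_order_on_relation_ofI) auto
next
  fix C assume "C \<in> Chains (relation_of (\<ge>) A)"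
  then have C: "\<And>a b. a \<in> C \<Longrightarrow> b \<in> C \<Longrightarrow> a \<in> A \<and> b \<in> A \<and> (a \<le> b \<or> b \<le> a)"
    unfolding Chains_def relation_of_def by blast
  show "\<exists>u\<in>A. \<forall>a\<in>C. a \<ge> u"
  proof (cases "C = {}")
    case False
    then show ?thesis using chain[of C] C by (metis subsetI)
  qed (use \<open>A \<noteq> {}\<close> in auto)
qed

definition sublinear :: "('y::real_vector \<Rightarrow> real) \<Rightarrow> bool" where
  "sublinear p \<longleftrightarrow> (\<forall>x y. p (x + y) \<le> p x + p y) \<and> (\<forall>t>0. \<forall>x. p (t *\<^sub>R x) \<le> t * p x)"

lemma sublinear_add: "sublinear p \<Longrightarrow> p (x + y) \<le> p x + p y"
  by (simp add: sublinear_def)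

text \<open>Scaling back by \<open>1/t\<close> reverses the inequality in the definition. For
  \<open>t = 0\<close>, the factors \<open>2\<close> and \<open>1/2\<close> force
  \<open>p 0 \<ge> 0\<close> and \<open>p 0 \<le> 0\<close>.\<close>

lemma sublinear_scaleR:
  assumes p: "sublinear p" and "t \<ge> 0"
  shows "p (t *\<^sub>R x) = t * p x"
proof (cases "t = 0")
  case True
  have "p (2 *\<^sub>R 0) \<le> 2 * p 0" "p ((1/2) *\<^sub>R 0) \<le> (1/2) * p 0"
    using p unfolding sublinear_def by (meson zero_less_numeral half_gt_zero zero_less_one)+
  then show ?thesis using True by simp
next
  case False
  then have t: "t > 0" using \<open>t \<ge> 0\<close> by simp
  have "p ((1/t) *\<^sub>R (t *\<^sub>R x)) \<le> (1/t) * p (t *\<^sub>R x)"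
    using p t unfolding sublinear_def by (meson zero_less_divide_1_iff)
  then have "t * p x \<le> p (t *\<^sub>R x)" using t by (simp add: field_simps)
  moreover have "p (t *\<^sub>R x) \<le> t * p x" using p t unfolding sublinear_def by blast
  ultimately show ?thesis by simp
qed

lemma sublinear_0: "sublinear p \<Longrightarrow> p 0 = 0"
  using sublinear_scaleR[of p 0 0] by simp

lemma sublinear_ge: "sublinear p \<Longrightarrow> - p (- x) \<le> p x"
  using sublinear_add[of p x "- x"] sublinear_0[of p] by simp

text \<open>\<open>S x\<close> is the fibre over \<open>x\<close> of a convex cone that plays the role of the epigraph.\<close>

lemma sublinear_Inf:
  fixes S :: "'y::real_vector \<Rightarrow> real set"
  assumes ne: "\<And>x. S x \<noteq> {}" and bdd: "\<And>x. bdd_below (S x)"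
    and add: "\<And>x y r s. r \<in> S x \<Longrightarrow> s \<in> S y \<Longrightarrow> r + s \<in> S (x + y)"
    and scale: "\<And>t x r. t > 0 \<Longrightarrow> r \<in> S x \<Longrightarrow> t * r \<in> S (t *\<^sub>R x)"
  shows "sublinear (\<lambda>x. Inf (S x))"
  unfolding sublinear_def
proof (intro conjI allI impI)
  fix x y
  have "Inf (S (x + y)) - s \<le> Inf (S x)" if "s \<in> S y" for s
    using cInf_lower[OF add[OF _ that] bdd]
    by (intro cInf_greatest[OF ne]) (auto simp: algebra_simps)
  then have "Inf (S (x + y)) - Inf (S x) \<le> Inf (S y)"
    by (intro cInf_greatest[OF ne]) (auto simp: algebra_simps)
  then show "Inf (S (x + y)) \<le> Inf (S x) + Inf (S y)" by simp
next
  fix t :: real and x assume t: "t > 0"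
  have "Inf (S (t *\<^sub>R x)) / t \<le> Inf (S x)"
  proof (rule cInf_greatest[OF ne])
    fix r assume "r \<in> S x"
    from cInf_lower[OF scale[OF t this] bdd] show "Inf (S (t *\<^sub>R x)) / t \<le> r"
      using t by (simp add: field_simps)
  qed
  then show "Inf (S (t *\<^sub>R x)) \<le> t * Inf (S x)" using t by (simp add: field_simps)
qed

text \<open>The functional \<open>q x\<close> is the infimum of
  \<open>p (x + t *\<^sub>R z) - t * p z\<close> over \<open>t \<ge> 0\<close>: the parameter
  \<open>0\<close> gives \<open>q \<le> p\<close> and the parameter \<open>1\<close> gives the
  second bound. Subadditivity bounds these numbers below by \<open>- p (- x)\<close>.\<close>

lemma sublinear_tilt:
  fixes p :: "'y::real_vector \<Rightarrow> real"
  assumes p: "sublinear p"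
  obtains q where "sublinear q" "q \<le> p" "\<And>x. q x \<le> p (x + z) - p z"
proof -
  \<comment> \<open>The sets are closed upwards, so membership of sums and multiples only needs an
    inequality for some parameter.\<close>
  define S where "S = (\<lambda>x. {r. \<exists>t\<ge>0. p (x + t *\<^sub>R z) - t * p z \<le> r})"
  have bdd: "bdd_below (S x)" for x
  proof (rule bdd_belowI)
    fix r assume "r \<in> S x"
    then obtain t where t: "t \<ge> 0" "p (x + t *\<^sub>R z) - t * p z \<le> r" by (auto simp: S_def)
    have "p (t *\<^sub>R z) \<le> p (x + t *\<^sub>R z) + p (- x)"
      using sublinear_add[OF p, of "x + t *\<^sub>R z" "- x"] by simp
    then show "- p (- x) \<le> r" using t sublinear_scaleR[OF p t(1), of z] by simp
  qed
  have mem: "t \<ge> 0 \<Longrightarrow> p (x + t *\<^sub>R z) - t * p z \<in> S x" for t x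
    by (auto simp: S_def)
  have "sublinear (\<lambda>x. Inf (S x))"
  proof (rule sublinear_Inf[OF _ bdd])
    show "S x \<noteq> {}" for x using mem[of 0] by auto
  next
    fix x y r s assume "r \<in> S x" "s \<in> S y"
    then obtain t u where tu: "t \<ge> 0" "u \<ge> 0" "p (x + t *\<^sub>R z) - t * p z \<le> r"
      "p (y + u *\<^sub>R z) - u * p z \<le> s" by (auto simp: S_def)
    have "p ((x + y) + (t + u) *\<^sub>R z) \<le> p (x + t *\<^sub>R z) + p (y + u *\<^sub>R z)"
      using sublinear_add[OF p, of "x + t *\<^sub>R z" "y + u *\<^sub>R z"] by (simp add: algebra_simps)
    then have "p ((x + y) + (t + u) *\<^sub>R z) - (t + u) * p z \<le> r + s"
      using tu by (simp add: algebra_simps)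
    then show "r + s \<in> S (x + y)"
      unfolding S_def using tu by (intro CollectI exI[of _ "t + u"]) auto
  next
    fix t :: real and x r assume t: "t > 0" "r \<in> S x"
    then obtain u where u: "u \<ge> 0" "p (x + u *\<^sub>R z) - u * p z \<le> r" by (auto simp: S_def)
    have "p (t *\<^sub>R x + (t * u) *\<^sub>R z) - (t * u) * p z = t * (p (x + u *\<^sub>R z) - u * p z)"
      using sublinear_scaleR[OF p, of t "x + u *\<^sub>R z"] t by (simp add: algebra_simps)
    also have "\<dots> \<le> t * r" using u t by simp
    finally show "t * r \<in> S (t *\<^sub>R x)"
      unfolding S_def using u t by (intro CollectI exI[of _ "t * u"]) auto
  qed
  moreover have "(\<lambda>x. Inf (S x)) \<le> p"
    using cInf_lower[OF mem[of 0] bdd] by (simp add: le_fun_def)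
  moreover have "Inf (S x) \<le> p (x + z) - p z" for x
    using cInf_lower[OF mem[of 1 x] bdd] by simp
  ultimately show ?thesis using that by blast
qed

text \<open>
  A minimal sublinear functional is linear, since tilting it in any direction cannot decrease it.
\<close>

lemma sublinear_dominates_linear:
  fixes p :: "'y::real_vector \<Rightarrow> real"
  assumes p: "sublinear p"
  obtains h where "linear h" "\<And>x. h x \<le> p x"
proof -
  define A where "A = {q. sublinear q \<and> q \<le> p}"
  have "p \<in> A" using p by (simp add: A_def)
  then have "A \<noteq> {}" by blast
  then have "\<exists>h\<in>A. \<forall>q\<in>A. q \<le> h \<longrightarrow> q = h"
  proof (rule Zorn_minimal)
    fix C assume C: "C \<noteq> {}" "C \<subseteq> A" and ch: "\<And>a b. a \<in> C \<Longrightarrow> b \<in> C \<Longrightarrow> a \<le> b \<or> b \<le> a"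
    define S where "S = (\<lambda>x. {r. \<exists>q\<in>C. q x \<le> r})"
    have bdd: "bdd_below (S x)" for x
    proof (rule bdd_belowI)
      fix r assume "r \<in> S x"
      then obtain q where q: "q \<in> C" "q x \<le> r" by (auto simp: S_def)
      then have "sublinear q" "q (- x) \<le> p (- x)" using C by (auto simp: A_def le_fun_def)
      then show "- p (- x) \<le> r" using sublinear_ge[of q x] q by linarith
    qed
    have lower: "Inf (S x) \<le> q x" if "q \<in> C" for q x
      using that by (intro cInf_lower bdd) (auto simp: S_def)
    have "sublinear (\<lambda>x. Inf (S x))"
    proof (rule sublinear_Inf[OF _ bdd])
      show "S x \<noteq> {}" for x using C by (auto simp: S_def)
    next
      fix x y r s assume "r \<in> S x" "s \<in> S y"
      then obtain a b where ab: "a \<in> C" "b \<in> C" "a x \<le> r" "b y \<le> s" by (auto simp: S_def)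
      \<comment> \<open>The bounds at \<open>x\<close> and \<open>y\<close> may come from different
        functionals; the smaller of the two in the chain satisfies both.\<close>
      obtain c where c: "c \<in> C" "c \<le> a" "c \<le> b" using ch ab by blast
      have "c (x + y) \<le> c x + c y" using c C by (intro sublinear_add) (auto simp: A_def)
      also have "\<dots> \<le> r + s" using c(2,3) ab by (meson add_mono le_funD order_trans)
      finally show "r + s \<in> S (x + y)" using c by (auto simp: S_def)
    next
      fix t :: real and x r assume t: "t > 0" "r \<in> S x"
      then obtain q where q: "q \<in> C" "q x \<le> r" by (auto simp: S_def)
      then have "q (t *\<^sub>R x) = t * q x" using C t by (intro sublinear_scaleR) (auto simp: A_def)
      also have "\<dots> \<le> t * r" using q t by simp
      finally show "t * r \<in> S (t *\<^sub>R x)" using q by (auto simp: S_def)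
    qed
    moreover have "(\<lambda>x. Inf (S x)) \<le> p"
    proof (rule le_funI)
      fix x
      obtain q where q: "q \<in> C" using C by blast
      then have "q x \<le> p x" using C by (auto simp: A_def le_fun_def)
      then show "Inf (S x) \<le> p x" using lower[OF q, of x] by simp
    qed
    ultimately show "\<exists>l\<in>A. \<forall>q\<in>C. l \<le> q"
      using lower by (intro bexI[of _ "\<lambda>x. Inf (S x)"]) (auto simp: A_def le_fun_def)
  qed
  then obtain h where h: "h \<in> A" "\<And>q. q \<in> A \<Longrightarrow> q \<le> h \<Longrightarrow> q = h" by blast
  have sub: "sublinear h" and hp: "h \<le> p" using h(1) by (auto simp: A_def)
  have add: "h (x + z) = h x + h z" for x z
  proof -
    \<comment> \<open>Minimality identifies the tilt with \<open>h\<close>, so its second bound says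
      that \<open>h\<close> is superadditive.\<close>
    obtain q where q: "sublinear q" "q \<le> h" "\<And>x. q x \<le> h (x + z) - h z"
      using sublinear_tilt[OF sub, of z] by metis
    then have "q = h" using h(2)[of q] hp by (auto simp: A_def)
    then have "h x \<le> h (x + z) - h z" using q(3) by simp
    then show ?thesis using sublinear_add[OF sub, of x z] by simp
  qed
  have "h (t *\<^sub>R x) = t *\<^sub>R h x" for t x
  proof (cases "t \<ge> 0")
    case False
    then have "h ((- t) *\<^sub>R x) = (- t) * h x" by (intro sublinear_scaleR[OF sub]) auto
    moreover have "h (t *\<^sub>R x) + h ((- t) *\<^sub>R x) = 0"
      using add[of "t *\<^sub>R x" "(- t) *\<^sub>R x"] sublinear_0[OF sub] by simp
    ultimately show ?thesis by simp
  qed (simp add: sublinear_scaleR[OF sub])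
  then have "linear h" using add by (intro linearI) auto
  then show ?thesis using hp that by (auto simp: le_fun_def)
qed

text \<open>An upper bound suffices because it applies to a small vector and to its negative. With
  the factor \<open>2 / e\<close> it yields \<open>\<bar>h x - h x0\<bar> \<le> e / 2\<close> for
  \<open>x\<close> near \<open>x0\<close>.\<close>

lemma continuous_on_linear_bounded_above:
  fixes h :: "'y::locally_convex_space \<Rightarrow> real"
  assumes h: "linear h" and U: "open U" "0 \<in> U" "\<And>u. u \<in> U \<Longrightarrow> h u \<le> 1"
  shows "continuous_on UNIV h"
  unfolding continuous_on_def
proof (intro ballI tendstoI)
  fix x0 :: 'y and e :: real assume e: "e > 0"
  have "((\<lambda>x. c *\<^sub>R (x - x0)) \<longlongrightarrow> c *\<^sub>R (x0 - x0)) (at x0)" for c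
    by (intro tendsto_scaleR_lcs tendsto_const tendsto_diff tendsto_ident_at)
  then have ev: "eventually (\<lambda>x. c *\<^sub>R (x - x0) \<in> U) (at x0)" for c
    by (rule topological_tendstoD) (use U in auto)
  show "eventually (\<lambda>x. dist (h x) (h x0) < e) (at x0)"
    using ev[of "2 / e"] ev[of "- (2 / e)"]
  proof eventually_elim
    case (elim x)
    have "h (c *\<^sub>R (x - x0)) = c * (h x - h x0)" for c
      using h by (simp add: linear_cmul linear_diff)
    then have "(2 / e) * (h x - h x0) \<le> 1" "- (2 / e) * (h x - h x0) \<le> 1"
      using U(3)[OF elim(1)] U(3)[OF elim(2)] by metis+
    then show ?case using e by (auto simp: dist_real_def field_simps abs_if)
  qed
qed

text \<open>Here \<open>p\<close> is the Minkowski gauge of \<open>U\<close>. A linear functional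
  below the gauge is at most \<open>1\<close> on \<open>U\<close>; tilting the gauge at
  \<open>y\<close> first also forces \<open>h (- y) \<le> p 0 - p y\<close>, that is
  \<open>h y \<ge> p y\<close>. The tilt thus takes the place of an extension from the line through
  \<open>y\<close>.\<close>

lemma separation_open_convex:
  fixes U :: "'y::locally_convex_space set"
  assumes U: "open U" "convex U" "0 \<in> U" and y: "y \<notin> U"
  obtains h :: "'y \<Rightarrow> real" where "linear h" "\<forall>u\<in>U. h u \<le> 1" "1 \<le> h y"
proof -
  define S where "S = (\<lambda>x. {t. t > 0 \<and> (\<exists>u\<in>U. x = t *\<^sub>R u)})"
  define p where "p = (\<lambda>x. Inf (S x))"
  have bdd: "bdd_below (S x)" for x by (rule bdd_belowI[of _ 0]) (auto simp: S_def)
  have ne: "S x \<noteq> {}" for x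
  proof -
    \<comment> \<open>An open neighbourhood of the origin is absorbing, which makes the gauge
      finite.\<close>
    have "((\<lambda>t::real. t *\<^sub>R x) \<longlongrightarrow> 0 *\<^sub>R x) (at_right 0)"
      by (intro tendsto_scaleR_lcs tendsto_const tendsto_ident_at)
    then have "eventually (\<lambda>t::real. t *\<^sub>R x \<in> U) (at_right 0)"
      by (rule topological_tendstoD) (use U in auto)
    then have "eventually (\<lambda>t::real. t *\<^sub>R x \<in> U \<and> t > 0) (at_right 0)"
      by (intro eventually_conj eventually_at_right_less)
    then obtain t :: real where "t *\<^sub>R x \<in> U" "t > 0"
      by (metis (mono_tags, lifting) eventually_happens' trivial_limit_at_right_real)
    then have "1 / t \<in> S x" by (auto simp: S_def intro!: bexI[of _ "t *\<^sub>R x"])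
    then show ?thesis by blast
  qed
  have "sublinear p"
    unfolding p_def
  proof (rule sublinear_Inf[OF ne bdd])
    fix x y r s assume "r \<in> S x" "s \<in> S y"
    then obtain u v where uv: "r > 0" "s > 0" "u \<in> U" "v \<in> U" "x = r *\<^sub>R u" "y = s *\<^sub>R v"
      by (auto simp: S_def)
    \<comment> \<open>The gauge is subadditive because \<open>r *\<^sub>R u + s *\<^sub>R v\<close>
      is \<open>r + s\<close> times a convex combination of \<open>u\<close> and
      \<open>v\<close>.\<close>
    let ?w = "(r / (r + s)) *\<^sub>R u + (s / (r + s)) *\<^sub>R v"
    have "?w \<in> U" using uv by (intro convexD[OF U(2)]) (auto simp: add_divide_distrib[symmetric])
    moreover have "x + y = (r + s) *\<^sub>R ?w" using uv by (simp add: scaleR_add_right)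
    ultimately show "r + s \<in> S (x + y)"
      using uv(1,2) unfolding S_def by (intro CollectI conjI bexI[of _ ?w]) auto
  qed (auto simp: S_def)
  then obtain q where q: "sublinear q" "q \<le> p" "\<And>x. q x \<le> p (x + y) - p y"
    using sublinear_tilt by metis
  obtain h where h: "linear h" "\<And>x. h x \<le> q x"
    using sublinear_dominates_linear[OF q(1)] by metis
  have "h u \<le> 1" if "u \<in> U" for u
  proof -
    have "1 \<in> S u" using that by (auto simp: S_def)
    then have "p u \<le> 1" unfolding p_def by (rule cInf_lower[OF _ bdd])
    then show ?thesis using h(2)[of u] q(2) by (meson le_funD order_trans)
  qed
  moreover have "1 \<le> h y"
  proof -
    \<comment> \<open>If \<open>t < 1\<close>, then \<open>y\<close> would be a convex combination
      of \<open>u\<close> and the origin, hence in \<open>U\<close>.\<close>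
    have "1 \<le> t" if t: "t \<in> S y" for t
    proof (rule ccontr)
      assume "\<not> 1 \<le> t"
      moreover obtain u where u: "u \<in> U" "y = t *\<^sub>R u" and "t > 0" using t unfolding S_def by blast
      ultimately have "t *\<^sub>R u + (1 - t) *\<^sub>R 0 \<in> U" by (intro convexD[OF U(2)] U(3)) auto
      then show False using u y by simp
    qed
    then have "1 \<le> p y" unfolding p_def by (intro cInf_greatest[OF ne])
    moreover have "h (- y) \<le> p 0 - p y"
      using h(2)[of "- y"] q(3)[of "- y"] by simp
    ultimately show ?thesis
      using sublinear_0[OF \<open>sublinear p\<close>] h(1) by (simp add: linear_neg)
  qed
  ultimately show ?thesis using h(1) that by blast
qed

text \<open>Fattening \<open>C\<close> by \<open>N\<close> and translating by \<open>c0\<close>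
  gives an open convex neighbourhood of the origin that misses \<open>y - c0\<close>. The room left
  by \<open>N\<close> turns the weak separation into a strict one.\<close>

lemma separation_closed_convex:
  fixes C :: "'y::locally_convex_space set"
  assumes C: "closed C" "convex C" "C \<noteq> {}" and y: "y \<notin> C"
  obtains h :: "'y \<Rightarrow> real" and c where "linear h" "continuous_on UNIV h" "h y < c" "\<And>z. z \<in> C \<Longrightarrow> c < h z"
proof -
  obtain N where N: "open N" "convex N" "0 \<in> N" "\<And>a. a \<in> N \<Longrightarrow> - a \<in> N"
    "\<And>k a b. k \<in> {y} \<Longrightarrow> a \<in> N \<Longrightarrow> b \<in> N \<Longrightarrow> k + a + b \<in> - C"
    using compact_uniform_nbhd[of "{y}" "- C"] C y by (metis Compl_iff compact_sing empty_subsetI insert_subset open_Compl)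
  obtain c0 where c0: "c0 \<in> C" using C by blast
  define U where "U = {k + a |k a. k \<in> (\<lambda>z. z - c0) ` C \<and> a \<in> N}"
  have U: "open U" "convex U" unfolding U_def
    using N C by (auto intro!: open_translates convex_translates)
  have UI: "z - c0 + a \<in> U" if "z \<in> C" "a \<in> N" for z a using that by (auto simp: U_def)
  have U0: "0 \<in> U" using UI[OF c0 N(3)] by simp
  have "y - c0 \<notin> U"
  proof
    assume "y - c0 \<in> U"
    then obtain z a where za: "z \<in> C" "a \<in> N" "y - c0 = z - c0 + a" by (auto simp: U_def)
    then have "y + - a + 0 = z" by (simp add: algebra_simps)
    then show False using N(3) N(4)[OF za(2)] N(5)[of y "- a" 0] za by auto
  qed
  then obtain h :: "'y \<Rightarrow> real" where h: "linear h" "\<forall>u\<in>U. h u \<le> 1" "1 \<le> h (y - c0)"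
    by (rule separation_open_convex[OF U U0])
  have cont: "continuous_on UNIV h" by (rule continuous_on_linear_bounded_above[OF h(1) U(1) U0]) (use h(2) in blast)
  \<comment> \<open>A small multiple of \<open>y - c0\<close> lies in \<open>N\<close>. Since
    \<open>h (y - c0) \<ge> 1\<close>, adding it to points of \<open>C\<close> gains at least
    \<open>t\<close>, which is the width of the gap.\<close>
  have "((\<lambda>t::real. t *\<^sub>R (y - c0)) \<longlongrightarrow> 0 *\<^sub>R (y - c0)) (at_right 0)"
    by (intro tendsto_scaleR_lcs tendsto_const tendsto_ident_at)
  then have "eventually (\<lambda>t::real. t *\<^sub>R (y - c0) \<in> N) (at_right 0)"
    by (rule topological_tendstoD) (use N in auto)
  then have "eventually (\<lambda>t::real. t *\<^sub>R (y - c0) \<in> N \<and> t > 0) (at_right 0)"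
    by (intro eventually_conj eventually_at_right_less)
  then obtain t :: real where t: "t *\<^sub>R (y - c0) \<in> N" "t > 0"
    by (metis (mono_tags, lifting) eventually_happens' trivial_limit_at_right_real)
  have "h z + t \<le> h y" if "z \<in> C" for z
  proof -
    have "h z - h c0 + t * h (y - c0) \<le> 1"
      using bspec[OF h(2) UI[OF that t(1)]] h(1) by (simp add: linear_add linear_diff linear_cmul)
    moreover have "t * 1 \<le> t * h (y - c0)" using h(3) t(2) by (intro mult_left_mono) auto
    moreover have "1 \<le> h y - h c0" using h(1,3) by (simp add: linear_diff)
    ultimately show ?thesis by simp
  qed
  then show ?thesis
    using t(2) cont h(1)
    \<comment> \<open>The functional is negated so that \<open>y\<close> lies on the lower side; the
      threshold is the middle of the gap from \<open>- h y\<close> to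
      \<open>t - h y\<close>.\<close>
    by (intro that[of "\<lambda>x. - h x" "t / 2 - h y"])
      (force intro: continuous_intros linear_compose_neg)+
qed

section \<open>Usco maps and minimality\<close>

lemma usc_mapD:
  assumes "usc_map F" "open V" "F x \<subseteq> V"
  shows "\<exists>U. open U \<and> x \<in> U \<and> (\<forall>u\<in>U. F u \<subseteq> V)"
  using assms unfolding usc_map_def by (simp add: UN_subset_iff)

lemma usc_mapI:
  assumes "\<And>x V. open V \<Longrightarrow> F x \<subseteq> V \<Longrightarrow> \<exists>U. open U \<and> x \<in> U \<and> (\<forall>u\<in>U. F u \<subseteq> V)"
  shows "usc_map F"
  using assms unfolding usc_map_def by (metis UN_least)

lemma minimal_usco_below:
  fixes F :: "'x::topological_space \<Rightarrow> 'y::t2_space set"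
  assumes F: "usco F"
  obtains G where "usco G" "G \<le> F" "\<And>H. usco H \<Longrightarrow> H \<le> G \<Longrightarrow> H = G"
proof -
  define A where "A = {G. usco G \<and> G \<le> F}"
  have "F \<in> A" using F by (simp add: A_def)
  then have "A \<noteq> {}" by blast
  then have "\<exists>G\<in>A. \<forall>H\<in>A. H \<le> G \<longrightarrow> H = G"
  proof (rule Zorn_minimal)
    fix C assume C: "C \<noteq> {}" "C \<subseteq> A" and ch: "\<And>a b. a \<in> C \<Longrightarrow> b \<in> C \<Longrightarrow> a \<le> b \<or> b \<le> a"
    have cpt: "compact (G x)" and ne: "G x \<noteq> {}" and usc: "usc_map G" if "G \<in> C" for G x
      using that C by (auto simp: A_def usco_def)
    define L where "L = (\<lambda>x. \<Inter>G\<in>C. G x)"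
    \<comment> \<open>By compactness finitely many members of the chain already have their
      intersection over \<open>x\<close> inside \<open>V\<close>, and the least of them lies in
      \<open>V\<close> alone. This gives upper semicontinuity of \<open>L\<close>, and with
      \<open>V = {}\<close> it shows that the values of \<open>L\<close> are nonempty.\<close>
    have some: "\<exists>G\<in>C. G x \<subseteq> V" if "open V" "L x \<subseteq> V" for x V
    proof -
      obtain G0 where G0: "G0 \<in> C" using C by blast
      have "open (- G x \<union> V)" if "G \<in> C" for G
        using that cpt \<open>open V\<close> by (intro open_Un open_Compl compact_imp_closed) auto
      moreover have "G0 x \<subseteq> (\<Union>G\<in>C. - G x \<union> V)"
        using \<open>L x \<subseteq> V\<close> C(1) by (auto simp: L_def)
      ultimately obtain I where I: "I \<subseteq> C" "finite I" "G0 x \<subseteq> (\<Union>G\<in>I. - G x \<union> V)"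
        by (rule compactE_image[OF cpt[OF G0]])
      obtain M where M: "M \<in> insert G0 I" "\<And>G. G \<in> insert G0 I \<Longrightarrow> G \<le> M \<Longrightarrow> M = G"
        using finite_has_minimal[of "insert G0 I"] I(2) by auto
      have le: "M \<le> G" if "G \<in> insert G0 I" for G
        using ch[of M G] M that I(1) G0 by blast
      then have "M x \<subseteq> G0 x" "\<And>G. G \<in> I \<Longrightarrow> M x \<subseteq> G x" by (auto simp: le_fun_def)
      then have "M x \<subseteq> V" using I(3) by blast
      then show ?thesis using M(1) I(1) G0 by blast
    qed
    have Lle: "L \<le> G" if "G \<in> C" for G using that by (auto simp: L_def le_fun_def)
    obtain G0 where G0: "G0 \<in> C" using C by blast
    have "usco L"
      unfolding usco_def
    proof (intro conjI allI usc_mapI)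
      fix x V assume V: "open V" "L x \<subseteq> V"
      obtain G where G: "G \<in> C" "G x \<subseteq> V" using some[OF V] by blast
      obtain U where "open U" "x \<in> U" "\<And>u. u \<in> U \<Longrightarrow> G u \<subseteq> V"
        using usc_mapD[OF usc[OF G(1)] V(1) G(2)] by metis
      then show "\<exists>U. open U \<and> x \<in> U \<and> (\<forall>u\<in>U. L u \<subseteq> V)"
        using Lle[OF G(1)] by (meson le_funD order_trans)
    next
      show "L x \<noteq> {}" for x using some[of "{}" x] ne by blast
    next
      fix x
      have "compact (G0 x \<inter> L x)"
        unfolding L_def using cpt G0
        by (intro compact_Int_closed closed_INT ballI compact_imp_closed) auto
      moreover have "G0 x \<inter> L x = L x" using G0 by (auto simp: L_def)
      ultimately show "compact (L x)" by simp
    qed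
    moreover have "L \<le> F" using Lle[OF G0] C G0 by (auto simp: A_def intro: order_trans)
    ultimately show "\<exists>l\<in>A. \<forall>a\<in>C. l \<le> a" using Lle by (auto simp: A_def)
  qed
  then obtain G where G: "G \<in> A" "\<And>H. H \<in> A \<Longrightarrow> H \<le> G \<Longrightarrow> H = G" by blast
  show ?thesis
  proof (rule that[of G])
    show "usco G" "G \<le> F" using G(1) by (auto simp: A_def)
    then show "H = G" if "usco H" "H \<le> G" for H
      using that by (intro G(2)) (auto simp: A_def intro: order_trans)
  qed
qed

lemma minimal_usco_subset_open:
  fixes G :: "'x::topological_space \<Rightarrow> 'y::t2_space set"
  assumes G: "usco G" and min: "\<And>H. usco H \<Longrightarrow> H \<le> G \<Longrightarrow> H = G"
    and U: "open U" "x \<in> U" and V: "open V" "y \<in> G x" "y \<in> V"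
  obtains u where "u \<in> U" "G u \<subseteq> V"
proof (rule ccontr)
  assume "\<not> thesis"
  then have no: "\<And>u. u \<in> U \<Longrightarrow> \<not> G u \<subseteq> V" using that by blast
  define H where "H = (\<lambda>u. if u \<in> U then G u - V else G u)"
  have usc: "usc_map G" and cpt: "\<And>x. compact (G x)" and ne: "\<And>x. G x \<noteq> {}"
    using G by (auto simp: usco_def)
  have "usco H"
    unfolding usco_def
  proof (intro conjI allI usc_mapI)
    fix u O' assume O': "open O'" "H u \<subseteq> O'"
    show "\<exists>N. open N \<and> u \<in> N \<and> (\<forall>v\<in>N. H v \<subseteq> O')"
    proof (cases "u \<in> U")
      case True
      \<comment> \<open>Semicontinuity of \<open>G\<close> is applied to the larger set
        \<open>O' \<union> V\<close>; inside \<open>U\<close> the part in \<open>V\<close> is then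
        removed again.\<close>
      then have "G u \<subseteq> O' \<union> V" using O' by (auto simp: H_def)
      then obtain N where "open N" "u \<in> N" "\<And>v. v \<in> N \<Longrightarrow> G v \<subseteq> O' \<union> V"
        using usc_mapD[OF usc open_Un[OF O'(1) V(1)]] by metis
      then show ?thesis
        using True U by (intro exI[of _ "N \<inter> U"]) (auto simp: H_def)
    next
      case False
      then have "G u \<subseteq> O'" using O' by (auto simp: H_def)
      then obtain N where "open N" "u \<in> N" "\<And>v. v \<in> N \<Longrightarrow> G v \<subseteq> O'"
        using usc_mapD[OF usc O'(1)] by metis
      then show ?thesis
        by (intro exI[of _ N]) (auto simp: H_def)
    qed
  next
    show "H u \<noteq> {}" for u using no ne by (auto simp: H_def)
    show "compact (H u)" for u using cpt V(1) by (auto simp: H_def intro: compact_diff)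
  qed
  moreover have "H \<le> G" by (auto simp: H_def le_fun_def)
  ultimately have "H x = G x" using min by metis
  then show False using U V by (auto simp: H_def)
qed

lemma minimal_usco_selection_quasicontinuous:
  fixes G :: "'x::topological_space \<Rightarrow> 'y::t2_space set"
  assumes G: "usco G" and min: "\<And>H. usco H \<Longrightarrow> H \<le> G \<Longrightarrow> H = G" and f: "\<And>x. f x \<in> G x"
  shows "quasicontinuous_on UNIV f"
  unfolding quasicontinuous_on_def
proof (intro ballI allI impI)
  fix x V U assume *: "f x \<in> interior V \<and> openin (top_of_set UNIV) U \<and> x \<in> U"
  then have U: "open U" "x \<in> U" by auto
  obtain u where u: "u \<in> U" "G u \<subseteq> interior V"
    using minimal_usco_subset_open[OF G min U open_interior f] * by metis
  \<comment> \<open>Upper semicontinuity spreads the inclusion from the single point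
    \<open>u\<close> to a neighbourhood.\<close>
  obtain N where "open N" "u \<in> N" "\<And>v. v \<in> N \<Longrightarrow> G v \<subseteq> interior V"
    using usc_mapD[of G "interior V" u] u(2) G unfolding usco_def by blast
  moreover have "interior V \<subseteq> V" by (rule interior_subset)
  ultimately show "\<exists>W. W \<noteq> {} \<and> openin (top_of_set UNIV) W \<and> W \<subseteq> U \<and> f ` W \<subseteq> V"
    using f U u by (intro exI[of _ "N \<inter> U"]) (auto simp: open_Int)
qed

text \<open>Suppose that no point clusters. Then finitely many open sets, each eventually avoided by
  the values, cover the compact set \<open>F x\<close>. Upper semicontinuity puts the values
  eventually into their union, a contradiction.\<close>

lemma usco_selection_subcontinuous:
  fixes F :: "'x::topological_space \<Rightarrow> 'y::topological_space set"
  assumes F: "usco F" and f: "\<And>x. x \<in> A \<Longrightarrow> f x \<in> F x"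
  shows "subcontinuous_on A f"
  unfolding subcontinuous_on_def
proof (intro allI impI)
  fix x and D :: "('x set \<times> 'x) set" and r s
  assume "directed_set D r \<and> s ` D \<subseteq> A \<and> (s \<longlongrightarrow> x) (tails D r)"
  then have D: "directed_set D r" and sA: "s ` D \<subseteq> A" and lim: "(s \<longlongrightarrow> x) (tails D r)" by auto
  have usc: "usc_map F" and cpt: "compact (F x)" using F by (auto simp: usco_def)
  show "has_convergent_subnet D r (f \<circ> s)"
  proof (rule ccontr)
    assume no: "\<not> has_convergent_subnet D r (f \<circ> s)"
    have "\<exists>V. open V \<and> y \<in> V \<and> eventually (\<lambda>j. f (s j) \<notin> V) (tails D r)" for y
    proof (rule ccontr)
      assume neg: "\<not> ?thesis"
      have "has_convergent_subnet D r (f \<circ> s)"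
      proof (rule has_convergent_subnetI[OF D, of y])
        fix V i assume "open V" "y \<in> V" "i \<in> D"
        then show "\<exists>j\<in>D. r i j \<and> (f \<circ> s) j \<in> V"
          using neg unfolding eventually_tails[OF D] by auto
      qed
      then show False using no by blast
    qed
    then obtain V where V: "\<And>y. open (V y)" "\<And>y. y \<in> V y"
      "\<And>y. eventually (\<lambda>j. f (s j) \<notin> V y) (tails D r)" by metis
    obtain I where I: "I \<subseteq> F x" "finite I" "F x \<subseteq> (\<Union>y\<in>I. V y)"
      by (rule compactE_image[OF cpt, of "F x" V]) (use V in blast)+
    obtain U where U: "open U" "x \<in> U" "\<And>u. u \<in> U \<Longrightarrow> F u \<subseteq> (\<Union>y\<in>I. V y)"
      using usc_mapD[OF usc open_UN I(3)] V(1) by meson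
    have "eventually (\<lambda>j. \<forall>y\<in>I. f (s j) \<notin> V y) (tails D r)"
      by (intro eventually_ball_finite I ballI V)
    moreover have "eventually (\<lambda>j. s j \<in> U) (tails D r)"
      using lim U by (intro topological_tendstoD)
    moreover have "eventually (\<lambda>j. j \<in> D) (tails D r)"
      unfolding eventually_tails[OF D] using D by (auto simp: directed_set_def)
    ultimately have "eventually (\<lambda>j. False) (tails D r)"
    proof eventually_elim
      case (elim j)
      then show ?case using f[of "s j"] U(3)[of "s j"] sA by blast
    qed
    then show False
      using D unfolding eventually_tails[OF D] directed_set_def by (meson reflp_onD)
  qed
qed

section \<open>Closure of the graph\<close>

lemma graph_closure_iff:
  "y \<in> graph_closure A f x \<longleftrightarrow>
     (\<forall>U V. open U \<and> x \<in> U \<and> open V \<and> y \<in> V \<longrightarrow> (\<exists>a\<in>A. a \<in> U \<and> f a \<in> V))"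
proof
  assume y: "y \<in> graph_closure A f x"
  show "\<forall>U V. open U \<and> x \<in> U \<and> open V \<and> y \<in> V \<longrightarrow> (\<exists>a\<in>A. a \<in> U \<and> f a \<in> V)"
  proof (intro allI impI)
    fix U V assume *: "open U \<and> x \<in> U \<and> open V \<and> y \<in> V"
    then have "open (U \<times> V)" "(x, y) \<in> U \<times> V" by (auto simp: open_Times)
    then have "{(a, f a) |a. a \<in> A} \<inter> U \<times> V \<noteq> {}"
      using y unfolding graph_closure_def closure_iff_nhds_not_empty by blast
    then show "\<exists>a\<in>A. a \<in> U \<and> f a \<in> V" by blast
  qed
next
  assume R: "\<forall>U V. open U \<and> x \<in> U \<and> open V \<and> y \<in> V \<longrightarrow> (\<exists>a\<in>A. a \<in> U \<and> f a \<in> V)"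
  show "y \<in> graph_closure A f x"
    unfolding graph_closure_def closure_iff_nhds_not_empty mem_Collect_eq
  proof (intro allI impI)
    fix S W assume "W \<subseteq> S" "open W" "(x, y) \<in> W"
    then obtain U V where "open U" "open V" "x \<in> U" "y \<in> V" "U \<times> V \<subseteq> W"
      by (metis mem_Sigma_iff open_prod_elim)
    moreover from this obtain a where "a \<in> A" "a \<in> U" "f a \<in> V" using R by metis
    ultimately have "(a, f a) \<in> {(a, f a) |a. a \<in> A} \<inter> S" using \<open>W \<subseteq> S\<close> by blast
    then show "{(a, f a) |a. a \<in> A} \<inter> S \<noteq> {}" by blast
  qed
qed

lemma graph_closure_mono: "B \<subseteq> A \<Longrightarrow> graph_closure B f x \<subseteq> graph_closure A f x"
  unfolding graph_closure_iff subset_iff by blast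

lemma closed_graph_closure: "closed (graph_closure A f x)"
proof -
  have "graph_closure A f x = (\<lambda>y. (x, y)) -` closure {(a, f a) |a. a \<in> A}"
    by (auto simp: graph_closure_def)
  then show ?thesis
    by (simp add: closed_vimage continuous_on_Pair)
qed

text \<open>The fibre of the closed graph over \<open>x\<close> depends only on the values of
  \<open>f\<close> near \<open>x\<close>.\<close>

lemma graph_closure_subset_closed:
  assumes U: "open U" "x \<in> U" and C: "closed C" "f ` (U \<inter> A) \<subseteq> C"
  shows "graph_closure A f x \<subseteq> C"
proof
  fix y assume y: "y \<in> graph_closure A f x"
  show "y \<in> C"
  proof (rule ccontr)
    assume "y \<notin> C"
    then obtain a where "a \<in> A" "a \<in> U" "f a \<in> - C"
      using y U C(1) unfolding graph_closure_iff by (metis Compl_iff open_Compl)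
    then show False using C(2) by blast
  qed
qed

text \<open>A usco map has a closed graph: a point \<open>y\<close> outside \<open>F x\<close> is
  separated from nearby values by a neighbourhood of \<open>F x\<close> whose closure misses
  \<open>y\<close>.\<close>

lemma graph_closure_subset_usco:
  fixes F :: "'x::topological_space \<Rightarrow> 'y::locally_convex_space set"
  assumes F: "usco F" and f: "\<And>x. x \<in> A \<Longrightarrow> f x \<in> F x"
  shows "graph_closure A f x \<subseteq> F x"
proof
  fix y assume y: "y \<in> graph_closure A f x"
  show "y \<in> F x"
  proof (rule ccontr)
    assume "y \<notin> F x"
    then have "F x \<subseteq> - {y}" "compact (F x)" using F by (auto simp: usco_def)
    then obtain W where W: "open W" "F x \<subseteq> W" "closure W \<subseteq> - {y}"
      using compact_nbhd_closure[of "F x" "- {y}"] by auto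
    obtain U where U: "open U" "x \<in> U" "\<And>u. u \<in> U \<Longrightarrow> F u \<subseteq> W"
      using usc_mapD[of F W x] W F unfolding usco_def by blast
    have "f ` (U \<inter> A) \<subseteq> closure W"
      using U(3) f closure_subset[of W] by blast
    then have "graph_closure A f x \<subseteq> closure W"
      by (intro graph_closure_subset_closed[OF U(1,2)]) auto
    then show False using y W(3) by blast
  qed
qed

text \<open>The limit of a convergent subnet of values along points of \<open>B\<close> approaching
  \<open>x\<close> lies in the fibre. The version for a subset \<open>B\<close> allows an
  application to exceptional points only.\<close>

lemma subcontinuous_graph_closure_nonempty:
  assumes f: "subcontinuous_on A f" and B: "B \<subseteq> A" "x \<in> closure B"
  shows "graph_closure B f x \<noteq> {}"
proof -
  \<comment> \<open>The net picks points of \<open>B\<close> in ever smaller neighbourhoods of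
    \<open>x\<close>. Its index type is the one fixed in \<open>subcontinuous_on\<close>.\<close>
  define D where "D = {(U, a). open U \<and> x \<in> U \<and> a \<in> U \<inter> B}"
  define r where "r = (\<lambda>(U :: 'a set, a :: 'a) (U' :: 'a set, a' :: 'a). U' \<subseteq> U)"
  have ex: "\<exists>a. (U, a) \<in> D" if "open U" "x \<in> U" for U
  proof -
    have "U \<inter> B \<noteq> {}" using that B(2) open_Int_closure_eq_empty[of U B] by blast
    then show ?thesis using that by (auto simp: D_def)
  qed
  have dir: "directed_set D r"
    unfolding directed_set_def
  proof (intro conjI ballI)
    show "D \<noteq> {}" using ex[of UNIV] by auto
    show "reflp_on D r" by (auto simp: reflp_on_def r_def)
    show "transp_on D r" by (auto simp: transp_on_def r_def)
  next
    fix i j assume "i \<in> D" "j \<in> D"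
    then obtain U V where UV: "open U" "x \<in> U" "open V" "x \<in> V" "fst i = U" "fst j = V"
      by (auto simp: D_def)
    then obtain a where "(U \<inter> V, a) \<in> D" using ex[of "U \<inter> V"] by auto
    then show "\<exists>k\<in>D. r i k \<and> r j k"
      using UV by (intro bexI[of _ "(U \<inter> V, a)"]) (auto simp: r_def split: prod.splits)
  qed
  have "(snd \<longlongrightarrow> x) (tails D r)"
  proof (rule topological_tendstoI)
    fix U assume U: "open U" "x \<in> U"
    then obtain a where a: "(U, a) \<in> D" using ex by blast
    show "eventually (\<lambda>d. snd d \<in> U) (tails D r)"
      unfolding eventually_tails[OF dir]
      by (rule bexI[OF _ a]) (auto simp: r_def D_def)
  qed
  moreover have "snd ` D \<subseteq> A" using B by (auto simp: D_def)
  ultimately have "has_convergent_subnet D r (f \<circ> snd)"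
    using f dir unfolding subcontinuous_on_def by blast
  then obtain E :: "(('a set \<times> 'a) \<times> 'b set) set" and q p y where
    sub: "subnet_index E q p D r" and conv: "((f \<circ> snd \<circ> p) \<longlongrightarrow> y) (tails E q)"
    unfolding has_convergent_subnet_def by blast
  have "y \<in> graph_closure B f x"
    unfolding graph_closure_iff
  proof (intro allI impI)
    fix U V assume *: "open U \<and> x \<in> U \<and> open V \<and> y \<in> V"
    then obtain a where a: "(U, a) \<in> D" using ex by blast
    obtain e where e: "e \<in> E" "r (U, a) (p e)" "(f \<circ> snd) (p e) \<in> V"
      using convergent_subnet_frequently[OF sub conv _ _ a] * by blast
    have "p e \<in> D" using sub e(1) by (auto simp: subnet_index_def)
    then have "snd (p e) \<in> B" "snd (p e) \<in> U" using e(2) by (auto simp: D_def r_def)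
    then show "\<exists>a\<in>B. a \<in> U \<and> f a \<in> V" using e(3) by auto
  qed
  then show ?thesis by blast
qed

lemma usco_graph_closure:
  fixes f :: "'x::topological_space \<Rightarrow> 'y::locally_convex_space"
  assumes f: "subcontinuous_on A f" and A: "closure A = UNIV"
    and cpt: "\<And>x. compact (graph_closure A f x)"
  shows "usco (graph_closure A f)"
  unfolding usco_def
proof (intro conjI allI usc_mapI cpt)
  show "graph_closure A f x \<noteq> {}" for x
    using subcontinuous_graph_closure_nonempty[OF f order_refl] A by blast
next
  fix x V assume V: "open V" "graph_closure A f x \<subseteq> V"
  obtain W where W: "open W" "graph_closure A f x \<subseteq> W" "closure W \<subseteq> V"
    using compact_nbhd_closure[OF cpt V] by metis
  \<comment> \<open>If the points with values outside \<open>W\<close> accumulated at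
    \<open>x\<close>, subcontinuity would give a point of the fibre that is outside
    \<open>W\<close>, although the whole fibre lies in \<open>W\<close>. So the complement of
    \<open>closure B\<close> is the required neighbourhood.\<close>
  define B where "B = {a\<in>A. f a \<notin> W}"
  have "graph_closure B f x \<subseteq> - W"
    using W(1) by (intro graph_closure_subset_closed[OF open_UNIV]) (auto simp: B_def)
  moreover have "graph_closure B f x \<subseteq> W"
    using graph_closure_mono[of B A f x] W(2) by (auto simp: B_def)
  ultimately have "x \<notin> closure B"
    using subcontinuous_graph_closure_nonempty[OF f, of B x] by (auto simp: B_def)
  moreover have "graph_closure A f u \<subseteq> V" if "u \<in> - closure B" for u
  proof -
    have "f ` (- closure B \<inter> A) \<subseteq> closure W"
      using closure_subset[of B] closure_subset[of W] by (auto simp: B_def)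
    then have "graph_closure A f u \<subseteq> closure W"
      by (intro graph_closure_subset_closed[OF _ that]) auto
    then show ?thesis using W(3) by blast
  qed
  ultimately show "\<exists>U. open U \<and> x \<in> U \<and> (\<forall>u\<in>U. graph_closure A f u \<subseteq> V)"
    by (intro exI[of _ "- closure B"]) auto
qed

text \<open>Local convexity enters through a convex neighbourhood \<open>W\<close> of the hull with
  closure in \<open>V\<close>: once \<open>H u\<close> is inside \<open>W\<close>, its closed convex
  hull is inside \<open>closure W\<close>.\<close>

lemma cusco_closed_convex_hull:
  fixes H :: "'x::topological_space \<Rightarrow> 'y::locally_convex_space set"
  assumes H: "usco H" and cpt: "\<And>x. compact (closed_convex_hull (H x))"
  shows "cusco (\<lambda>x. closed_convex_hull (H x))"
  unfolding cusco_def usco_def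
proof (intro conjI allI usc_mapI cpt convex_closed_convex_hull)
  show "closed_convex_hull (H x) \<noteq> {}" for x
    using H subset_closed_convex_hull[of "H x"] by (auto simp: usco_def)
next
  fix x V assume V: "open V" "closed_convex_hull (H x) \<subseteq> V"
  obtain W where W: "open W" "closed_convex_hull (H x) \<subseteq> W" "closure W \<subseteq> V" "convex W"
    using compact_nbhd_closure[OF cpt V] convex_closed_convex_hull by metis
  have "H x \<subseteq> W" using W(2) subset_closed_convex_hull[of "H x"] by blast
  then obtain U where U: "open U" "x \<in> U" "\<And>u. u \<in> U \<Longrightarrow> H u \<subseteq> W"
    using usc_mapD[of H W x] W(1) H unfolding usco_def by blast
  have "closed_convex_hull (H u) \<subseteq> V" if "u \<in> U" for u
  proof -
    have "closed_convex_hull (H u) \<subseteq> closure W"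
      using U(3)[OF that] closure_subset[of W]
      by (intro closed_convex_hull_least convex_closure_lcs W(4)) auto
    then show ?thesis using W(3) by blast
  qed
  then show "\<exists>U. open U \<and> x \<in> U \<and> (\<forall>u\<in>U. closed_convex_hull (H u) \<subseteq> V)"
    using U by blast
qed

section \<open>The characterization\<close>

lemma minimal_cusco_imp_quasicontinuous_selection:
  fixes F :: "'x::topological_space \<Rightarrow> 'y::locally_convex_space set"
  assumes F: "minimal_cusco F"
  obtains f where "\<And>x. f x \<in> F x" "quasicontinuous_on UNIV f" "subcontinuous_on UNIV f"
    "\<And>x. closed_convex_hull (graph_closure UNIV f x) = F x"
proof -
  have usco: "usco F" and cpt: "\<And>x. compact (F x)" and conv: "\<And>x. convex (F x)"
    using F by (auto simp: minimal_cusco_def cusco_def usco_def)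
  obtain G where G: "usco G" "G \<le> F" and min: "\<And>H. usco H \<Longrightarrow> H \<le> G \<Longrightarrow> H = G"
    using minimal_usco_below[OF usco] by metis
  have "\<forall>x. \<exists>y. y \<in> G x" using G(1) by (auto simp: usco_def)
  then obtain f where fG: "\<And>x. f x \<in> G x" by metis
  \<comment> \<open>The smaller map \<open>G\<close> serves quasicontinuity; the larger map
    \<open>F\<close> supplies the compact convex values that contain the hulls.\<close>
  then have fF: "\<And>x. f x \<in> F x" using G(2) by (auto simp: le_fun_def)
  have sub: "subcontinuous_on UNIV f" by (rule usco_selection_subcontinuous[OF usco fF])
  have grF: "graph_closure UNIV f x \<subseteq> F x" for x
    by (rule graph_closure_subset_usco[OF usco fF])
  have hullF: "closed_convex_hull (graph_closure UNIV f x) \<subseteq> F x" for x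
    by (intro closed_convex_hull_least grF conv compact_imp_closed cpt)
  have "compact (graph_closure UNIV f x)" for x
    using compact_Int_closed[OF cpt closed_graph_closure] grF by (metis inf.absorb2)
  then have "usco (graph_closure UNIV f)" by (intro usco_graph_closure[OF sub]) auto
  moreover have "compact (closed_convex_hull (graph_closure UNIV f x))" for x
  proof -
    have "closed (closed_convex_hull (graph_closure UNIV f x))" by (simp add: closed_convex_hull_def)
    then show ?thesis using compact_Int_closed[OF cpt] hullF by (metis inf.absorb2)
  qed
  ultimately have "cusco (\<lambda>x. closed_convex_hull (graph_closure UNIV f x))"
    by (rule cusco_closed_convex_hull)
  then have "(\<lambda>x. closed_convex_hull (graph_closure UNIV f x)) = F"
    using F hullF unfolding minimal_cusco_def by blast
  then show ?thesis
    using that fF sub minimal_usco_selection_quasicontinuous[OF G(1) min fG] by metis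
qed

lemma open_open_half_space: "open_half_space W \<Longrightarrow> open W"
  unfolding open_half_space_def by (auto intro: open_Collect_less continuous_on_const)

lemma quasicontinuous_imp_hyperplane_minimal:
  assumes "quasicontinuous_on A f"
  shows "hyperplane_minimal_on A f"
  unfolding hyperplane_minimal_on_def
proof (intro allI impI)
  fix W U assume *: "open_half_space W \<and> openin (top_of_set A) U \<and> f ` U \<inter> W \<noteq> {}"
  then obtain x where x: "x \<in> U" "f x \<in> W" by blast
  moreover have "x \<in> A" using x * openin_imp_subset by blast
  moreover have "interior W = W" using * by (simp add: open_open_half_space interior_open)
  ultimately show "\<exists>V. V \<noteq> {} \<and> openin (top_of_set A) V \<and> V \<subseteq> U \<and> f ` V \<subseteq> W"
    using assms * unfolding quasicontinuous_on_def by blast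
qed

lemma hyperplane_minimal_imp_minimal_cusco:
  fixes F :: "'x::topological_space \<Rightarrow> 'y::locally_convex_space set"
  assumes cpt: "\<And>x. compact (F x)" and A: "closure A = UNIV"
    and hyp: "hyperplane_minimal_on A f" and sub: "subcontinuous_on A f"
    and hull: "\<And>x. closed_convex_hull (graph_closure A f x) = F x"
  shows "minimal_cusco F"
  unfolding minimal_cusco_def
proof (intro conjI allI impI)
  let ?H = "graph_closure A f"
  have "compact (?H x)" for x
    using compact_Int_closed[OF cpt closed_graph_closure] subset_closed_convex_hull hull
    by (metis inf.absorb2)
  then have "cusco (\<lambda>x. closed_convex_hull (?H x))"
    using cpt hull by (intro cusco_closed_convex_hull usco_graph_closure[OF sub A]) auto
  then show "cusco F" by (simp add: hull)
next
  let ?H = "graph_closure A f"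
  fix G assume "cusco G \<and> (\<forall>x. G x \<subseteq> F x)"
  then have usc: "usc_map G" and ne: "\<And>x. G x \<noteq> {}" and closed: "\<And>x. closed (G x)"
    and conv: "\<And>x. convex (G x)" and GF: "\<And>x. G x \<subseteq> F x"
    by (auto simp: cusco_def usco_def compact_imp_closed)
  have "?H x \<subseteq> G x" for x
  proof (rule ccontr)
    assume "\<not> ?H x \<subseteq> G x"
    then obtain y where y: "y \<in> ?H x" "y \<notin> G x" by blast
    obtain h :: "'y \<Rightarrow> real" and c where h: "linear h" "continuous_on UNIV h" "h y < c"
        "\<And>z. z \<in> G x \<Longrightarrow> c < h z"
      using separation_closed_convex[OF closed conv ne y(2)] by metis
    have op: "open {z. c < h z}" "open {z. h z < c}" and cl: "closed {z. h z \<le> c}"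
      using h(2) by (auto intro: open_Collect_less closed_Collect_le continuous_on_const)
    have Gx: "G x \<subseteq> {z. c < h z}" using h(4) by blast
    obtain U where U: "open U" "x \<in> U" "\<And>u. u \<in> U \<Longrightarrow> G u \<subseteq> {z. c < h z}"
      using usc_mapD[OF usc op(1)] Gx by metis
    have "\<exists>a\<in>A. a \<in> U \<and> f a \<in> {z. h z < c}"
      using y(1)[unfolded graph_closure_iff, rule_format, of U "{z. h z < c}"] U(1,2) op(2) h(3)
      by simp
    then obtain a where a: "a \<in> A" "a \<in> U" "h (f a) < c" by blast
    \<comment> \<open>The functional takes different values at \<open>y\<close> and at any point of
      the nonempty set \<open>G x\<close>.\<close>
    have "h \<noteq> (\<lambda>_. 0)" using h(3,4) ne[of x] by force
    then have "open_half_space {z. h z < c}" using h unfolding open_half_space_def by blast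
    moreover have "openin (top_of_set A) (A \<inter> U)" using U(1) by (simp add: openin_open_Int)
    moreover have "f ` (A \<inter> U) \<inter> {z. h z < c} \<noteq> {}" using a by blast
    ultimately obtain V where V: "V \<noteq> {}" "openin (top_of_set A) V" "V \<subseteq> A \<inter> U"
        "f ` V \<subseteq> {z. h z < c}"
      using hyp unfolding hyperplane_minimal_on_def by meson
    obtain T where T: "open T" "V = A \<inter> T" using V(2) by (auto simp: openin_open)
    obtain v where v: "v \<in> V" using V(1) by blast
    \<comment> \<open>Since \<open>f\<close> maps the trace of the open set \<open>T\<close> on
      \<open>A\<close> into the half-space, the closed graph over \<open>v\<close> stays in the
      closed half-space. Strictness is lost in the closure, but the inequality on \<open>G v\<close>
      is strict, so a contradiction remains.\<close>
    have "?H v \<subseteq> {z. h z \<le> c}"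
      using T v V(4) by (intro graph_closure_subset_closed[OF T(1) _ cl]) force+
    moreover have "convex {z. h z \<le> c}"
    proof -
      have "{z. h z \<le> c} = h -` {..c}" by auto
      then show ?thesis using convex_linear_vimage[OF h(1)] by simp
    qed
    ultimately have "F v \<subseteq> {z. h z \<le> c}"
      using closed_convex_hull_least cl hull by metis
    moreover have "G v \<subseteq> {z. c < h z}" using U(3) v V(3) by blast
    ultimately show False using GF[of v] ne[of v] by fastforce
  qed
  then have "F x \<subseteq> G x" for x
    using closed_convex_hull_least[OF _ conv closed] hull by metis
  then show "G = F" using GF by (intro ext) blast
qed

theorem theorem2p5:
  fixes F :: "'x::t2_space \<Rightarrow> 'y::locally_convex_space set"
  shows "(minimal_cusco F \<longleftrightarrow>
            (\<forall>x. F x \<noteq> {} \<and> compact (F x)) \<and>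
            (\<exists>A f. densely_defined_selection A f F \<and>
               quasicontinuous_on A f \<and> subcontinuous_on A f \<and>
               (\<forall>x. closed_convex_hull (graph_closure A f x) = F x)))
       \<and> (minimal_cusco F \<longleftrightarrow>
            (\<forall>x. F x \<noteq> {} \<and> compact (F x)) \<and>
            (\<exists>A f. densely_defined_selection A f F \<and>
               hyperplane_minimal_on A f \<and> subcontinuous_on A f \<and>
               (\<forall>x. closed_convex_hull (graph_closure A f x) = F x)))"
    (is "(?min \<longleftrightarrow> ?cpt \<and> (\<exists>A f. ?Q A f)) \<and> (_ \<longleftrightarrow> _ \<and> (\<exists>A f. ?M A f))")
proof -
  have 12: "?cpt \<and> (\<exists>A f. ?Q A f)" if F: ?min
  proof
    show ?cpt using F by (simp add: minimal_cusco_def cusco_def usco_def)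
    obtain f where "\<And>x. f x \<in> F x" "quasicontinuous_on UNIV f" "subcontinuous_on UNIV f"
      "\<And>x. closed_convex_hull (graph_closure UNIV f x) = F x"
      using minimal_cusco_imp_quasicontinuous_selection[OF F] by metis
    \<comment> \<open>The selection is defined on the whole space, so density of its domain is
      trivial.\<close>
    then have "?Q UNIV f" by (simp add: densely_defined_selection_def)
    then show "\<exists>A f. ?Q A f" by blast
  qed
  have 23: "\<exists>A f. ?M A f" if "\<exists>A f. ?Q A f"
    using that quasicontinuous_imp_hyperplane_minimal by blast
  have 31: ?min if "?cpt" "\<exists>A f. ?M A f"
    using that hyperplane_minimal_imp_minimal_cusco[of F]
    unfolding densely_defined_selection_def by metis
  show ?thesis using 12 23 31 by blast
qed

end
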